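(* Let $\mathcal J=\{1,2\}$, let $\mathbf X_a,\mathbf X_b>0$, and for $j\in\{1,2\}$ let $\beta^m_j>0$, $\varepsilon_j>0$ and $\beta^c_j\in\mathbb R$. Consider the two-player game $\mathcal G$ in which each player $i\in\{a,b\}$ chooses $x^i\in\Omega_i$ so as to maximize $\mathbf u_i(x^i,x^{-i})$, where $$\Omega_i=\{x^i\in\mathbb R^{2}_{\ge 0} : x^i_1+x^i_2=\mathbf X_i\},\qquad \mathbf u_i(x^i,x^{-i})=\sum_{j=1}^{2}x^i_j\left(\frac{\beta^m_j}{x^i_j+x^{-i}_j+\varepsilon_j}-\beta^c_j\right).$$ Define $$\mathbf{\overline V}=\beta^c_2-\beta^c_1+\frac{\beta^m_1}{\varepsilon_1}-\frac{\beta^m_2(\mathbf X_a+\varepsilon_2)}{(\mathbf X_a+\mathbf X_b+\varepsilon_2)^2},\qquad \mathbf{\underline W}=\beta^c_2-\beta^c_1+\frac{\beta^m_1(\mathbf X_a+\varepsilon_1)}{(\mathbf X_a+\mathbf X_b+\varepsilon_1)^2}-\frac{\beta^m_2}{\varepsilon_2}.$$ Let $z_1^*,z_2^*\in[0,\mathbf X_b]$ be such that, in $\overline x_1^T=[0,\mathbf X_a,z_1^*,\mathbf X_b-z_1^*]$ and in $\overline x_2^T=[\mathbf X_a,0,z_2^*,\mathbf X_b-z_2^*]$, the strategy of player $b$ solves player $b$'s best-response problem; that is, $(z_1^*,\mathbf X_b-z_1^* )$ maximizes $\mathbf u_b(\cdot,(0,\mathbf X_a))$ over $\Omega_b$ and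 $(z_2^*,\mathbf X_b-z_2^* )$ maximizes $\mathbf u_b(\cdot,(\mathbf X_a,0))$ over $\Omega_b$. Then $\overline x_1$ is the Nash equilibrium of $\mathcal G$ if and only if $$z_1^*\in(0,\mathbf X_b)\ \text{ and }\ \frac{(\mathbf X_b-z_1^*-\mathbf X_a)\beta^m_2}{(\mathbf X_a+\mathbf X_b-z_1^*+\varepsilon_2)^2}-\frac{\beta^m_1z_1^*}{(z_1^*+\varepsilon_1)^2}\ge 0,$$ or $$z_1^*=0\ \text{ and }\ -\mathbf{\overline V}+\frac{(\mathbf X_b-\mathbf X_a)\beta^m_2}{(\mathbf X_a+\mathbf X_b+\varepsilon_2)^2}\ge 0.$$ In addition, $\overline x_2$ is the Nash equilibrium of $\mathcal G$ if and only if $$z_2^*\in(0,\mathbf X_b)\ \text{ and }\ \frac{(z_2^*-\mathbf X_a)\beta^m_1}{(\mathbf X_a+z_2^*+\varepsilon_1)^2}-\frac{(\mathbf X_b-z_2^* )\beta^m_2}{(\mathbf X_b-z_2^*+\varepsilon_2)^2}\ge 0,$$ or $$z_2^*=\mathbf X_b\ \text{ and }\ \mathbf{\underline W}+\frac{(\mathbf X_b-\mathbf X_a)\beta^m_1}{(\mathbf X_a+\mathbf X_b+\varepsilon_1)^2}\ge 0.$$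
   Context: For $i\in\{a,b\}$, $-i$ denotes the other player. Joint strategies are written as $x^T=[x^a_1,x^a_2,x^b_1,x^b_2]$. A joint strategy $\overline x=(\overline x^a,\overline x^b)\in\Omega_a\times\Omega_b$ is a (pure) Nash equilibrium of $\mathcal G$ if for all $i\in\{a,b\}$ and all $x^i\in\Omega_i$ one has $\mathbf u_i(\overline x^i,\overline x^{-i})\ge \mathbf u_i(x^i,\overline x^{-i})$. The first argument of $\mathbf u_b$ is player $b$'s strategy and the second is player $a$'s strategy. *)

theory Defs
  imports "HOL-Analysis.Analysis"
begin

datatype player = Player_a | Player_b

fun opponent :: "player \<Rightarrow> player" where
  "opponent Player_a = Player_b"
| "opponent Player_b = Player_a"

text \<open>The index set \<open>{1, 2}\<close> is the type \<open>2\<close>. A joint strategy maps each player to a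
  vector in \<open>real ^ 2\<close>.\<close>

definition profile :: "real ^ 2 \<Rightarrow> real ^ 2 \<Rightarrow> player \<Rightarrow> real ^ 2" where
  "profile xa xb i = (case i of Player_a \<Rightarrow> xa | Player_b \<Rightarrow> xb)"

definition strategies :: "(player \<Rightarrow> real) \<Rightarrow> player \<Rightarrow> (real ^ 2) set" where
  "strategies X i = {x. (\<forall>j. x $ j \<ge> 0) \<and> x $ 1 + x $ 2 = X i}"

text \<open>The two players' payoff functions coincide when written with a player's own strategy
  \<open>x\<close> first and the opponent's strategy \<open>y\<close> second, so there is no player index.\<close>

definition utility ::
    "real ^ 2 \<Rightarrow> real ^ 2 \<Rightarrow> real ^ 2 \<Rightarrow> real ^ 2 \<Rightarrow> real ^ 2 \<Rightarrow> real" where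
  "utility \<beta>m \<beta>c \<epsilon> x y =
     (\<Sum>j\<in>UNIV. x $ j * (\<beta>m $ j / (x $ j + y $ j + \<epsilon> $ j) - \<beta>c $ j))"

definition solves_best_response ::
    "real ^ 2 \<Rightarrow> real ^ 2 \<Rightarrow> real ^ 2 \<Rightarrow> (player \<Rightarrow> real) \<Rightarrow> player \<Rightarrow> real ^ 2 \<Rightarrow> real ^ 2 \<Rightarrow> bool"
  where
  "solves_best_response \<beta>m \<beta>c \<epsilon> X i x y \<longleftrightarrow>
     x \<in> strategies X i \<and>
     (\<forall>x' \<in> strategies X i. utility \<beta>m \<beta>c \<epsilon> x y \<ge> utility \<beta>m \<beta>c \<epsilon> x' y)"

definition nash_equilibrium ::
    "real ^ 2 \<Rightarrow> real ^ 2 \<Rightarrow> real ^ 2 \<Rightarrow> (player \<Rightarrow> real) \<Rightarrow> (player \<Rightarrow> real ^ 2) \<Rightarrow> bool"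
  where
  "nash_equilibrium \<beta>m \<beta>c \<epsilon> X x \<longleftrightarrow>
     (\<forall>i. x i \<in> strategies X i) \<and>
     (\<forall>i. \<forall>x' \<in> strategies X i.
        utility \<beta>m \<beta>c \<epsilon> (x i) (x (opponent i)) \<ge> utility \<beta>m \<beta>c \<epsilon> x' (x (opponent i)))"

definition V_upper :: "real ^ 2 \<Rightarrow> real ^ 2 \<Rightarrow> real ^ 2 \<Rightarrow> (player \<Rightarrow> real) \<Rightarrow> real" where
  "V_upper \<beta>m \<beta>c \<epsilon> X =
     \<beta>c $ 2 - \<beta>c $ 1 + \<beta>m $ 1 / \<epsilon> $ 1
     - \<beta>m $ 2 * (X Player_a + \<epsilon> $ 2) / (X Player_a + X Player_b + \<epsilon> $ 2)\<^sup>2"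

definition W_lower :: "real ^ 2 \<Rightarrow> real ^ 2 \<Rightarrow> real ^ 2 \<Rightarrow> (player \<Rightarrow> real) \<Rightarrow> real" where
  "W_lower \<beta>m \<beta>c \<epsilon> X =
     \<beta>c $ 2 - \<beta>c $ 1
     + \<beta>m $ 1 * (X Player_a + \<epsilon> $ 1) / (X Player_a + X Player_b + \<epsilon> $ 1)\<^sup>2
     - \<beta>m $ 2 / \<epsilon> $ 2"

end

theory Submission
  imports Defs
begin

text \<open>
  A player's payoff is strictly concave along the segment of its strategies, so a best response is
  characterised by the sign of the difference of the marginal payoffs of the two resources. Inserting
  the first-order condition of player \<open>b\<close> into that of player \<open>a\<close> eliminates \<open>\<beta>c\<close> and yields the
  stated inequalities. Uniqueness is Rosen's argument: on each resource, the marginal payoffs of the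
  two players form a strictly monotone (decreasing) field, so the variational inequalities of two
  different equilibria contradict each other.
\<close>

section \<open>Marginal payoffs and the first-order description of best responses\<close>

text \<open>This is the partial derivative of \<open>utility\<close> in the own coordinate
  \<open>x $ j\<close>, with the opponent's \<open>y\<close> fixed.\<close>

definition marginal_payoff ::
    "real ^ 2 \<Rightarrow> real ^ 2 \<Rightarrow> real ^ 2 \<Rightarrow> real ^ 2 \<Rightarrow> real ^ 2 \<Rightarrow> 2 \<Rightarrow> real" where
  "marginal_payoff \<beta>m \<beta>c \<epsilon> x y j =
     \<beta>m $ j * (y $ j + \<epsilon> $ j) / (x $ j + y $ j + \<epsilon> $ j)\<^sup>2 - \<beta>c $ j"

text \<open>The derivative of the payoff along (1, -1), the only direction, up to scaling, that
  preserves the total \<open>x $ 1 + x $ 2\<close>.\<close>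

definition marginal_gap ::
    "real ^ 2 \<Rightarrow> real ^ 2 \<Rightarrow> real ^ 2 \<Rightarrow> real ^ 2 \<Rightarrow> real ^ 2 \<Rightarrow> real" where
  "marginal_gap \<beta>m \<beta>c \<epsilon> x y =
     marginal_payoff \<beta>m \<beta>c \<epsilon> x y 1 - marginal_payoff \<beta>m \<beta>c \<epsilon> x y 2"

lemma vec2_eq_iff: "x = y \<longleftrightarrow> x $ 1 = y $ 1 \<and> x $ 2 = y $ 2" for x y :: "'a ^ 2"
  by (simp add: vec_eq_iff forall_2)

lemma payoff_difference:
  fixes t t' w \<beta> c :: real
  assumes "t + w > 0" and "t' + w > 0"
  shows "t' * (\<beta> / (t' + w) - c) - t * (\<beta> / (t + w) - c)
    = (t' - t) * (\<beta> * w / ((t + w) * (t' + w)) - c)"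
proof -
  have "t' * (\<beta> / (t' + w)) - t * (\<beta> / (t + w)) = (t' - t) * (\<beta> * w / ((t + w) * (t' + w)))"
    using assms by (simp add: divide_simps) (simp add: algebra_simps)
  then show ?thesis
    by (simp add: algebra_simps)
qed

lemma utility_difference:
  assumes "x \<in> strategies X i" and "x' \<in> strategies X i"
    and "\<And>j. y $ j \<ge> 0" and "\<And>j. \<epsilon> $ j > 0"
  shows "utility \<beta>m \<beta>c \<epsilon> x' y - utility \<beta>m \<beta>c \<epsilon> x y = (x' $ 1 - x $ 1) *
    ((\<beta>m $ 1 * (y $ 1 + \<epsilon> $ 1)
        / ((x $ 1 + (y $ 1 + \<epsilon> $ 1)) * (x' $ 1 + (y $ 1 + \<epsilon> $ 1))) - \<beta>c $ 1)
     - (\<beta>m $ 2 * (y $ 2 + \<epsilon> $ 2)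
        / ((x $ 2 + (y $ 2 + \<epsilon> $ 2)) * (x' $ 2 + (y $ 2 + \<epsilon> $ 2))) - \<beta>c $ 2))"
proof -
  have pos: "x $ j + (y $ j + \<epsilon> $ j) > 0" "x' $ j + (y $ j + \<epsilon> $ j) > 0" for j
    using assms by (auto simp: strategies_def intro!: add_nonneg_pos)
  have shift: "x' $ 2 - x $ 2 = - (x' $ 1 - x $ 1)"
    using assms(1,2) by (auto simp: strategies_def)
  have "utility \<beta>m \<beta>c \<epsilon> x' y - utility \<beta>m \<beta>c \<epsilon> x y
    = (x' $ 1 * (\<beta>m $ 1 / (x' $ 1 + (y $ 1 + \<epsilon> $ 1)) - \<beta>c $ 1)
        - x $ 1 * (\<beta>m $ 1 / (x $ 1 + (y $ 1 + \<epsilon> $ 1)) - \<beta>c $ 1))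
      + (x' $ 2 * (\<beta>m $ 2 / (x' $ 2 + (y $ 2 + \<epsilon> $ 2)) - \<beta>c $ 2)
        - x $ 2 * (\<beta>m $ 2 / (x $ 2 + (y $ 2 + \<epsilon> $ 2)) - \<beta>c $ 2))"
    by (simp add: utility_def sum_2 add.assoc)
  also note payoff_difference[OF pos[of 1]]
  also note payoff_difference[OF pos[of 2]]
  also note shift
  finally show ?thesis
    by (simp only: mult_minus_left add_uminus_conv_diff right_diff_distrib[symmetric])
qed

text \<open>Moving an amount s from resource 2 to resource 1 changes the payoff by s * G s, where
  \<open>G\<close> is continuous and decreasing and \<open>G 0\<close> is the marginal gap.
  Monotonicity of \<open>G\<close> turns the sign conditions at 0 into global optimality; for the
  converse, s tends to 0 from each side on which moving is feasible.\<close>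

lemma solves_best_response_iff:
  assumes y: "\<And>j. y $ j \<ge> 0" and \<beta>: "\<And>j. \<beta>m $ j > 0" and \<epsilon>: "\<And>j. \<epsilon> $ j > 0"
  shows "solves_best_response \<beta>m \<beta>c \<epsilon> X i x y \<longleftrightarrow> x \<in> strategies X i
    \<and> (x $ 2 > 0 \<longrightarrow> marginal_gap \<beta>m \<beta>c \<epsilon> x y \<le> 0)
    \<and> (x $ 1 > 0 \<longrightarrow> marginal_gap \<beta>m \<beta>c \<epsilon> x y \<ge> 0)"
proof (cases "x \<in> strategies X i")
  case False
  then show ?thesis by (simp add: solves_best_response_def)
next
  case True
  define w where "w j = y $ j + \<epsilon> $ j" for j
  define G where "G s = \<beta>m $ 1 * w 1 / ((x $ 1 + w 1) * (x $ 1 + s + w 1)) - \<beta>c $ 1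
    - (\<beta>m $ 2 * w 2 / ((x $ 2 + w 2) * (x $ 2 - s + w 2)) - \<beta>c $ 2)" for s
  have w: "w j > 0" for j
    using y \<epsilon> by (simp add: w_def add_nonneg_pos)
  have x: "x $ 1 \<ge> 0" "x $ 2 \<ge> 0" "x $ 1 + x $ 2 = X i"
    using True by (auto simp: strategies_def)
  have pos: "x $ 1 + w 1 > 0" "x $ 2 + w 2 > 0"
    using w x by (auto intro: add_nonneg_pos)
  have G0: "G 0 = marginal_gap \<beta>m \<beta>c \<epsilon> x y"
    by (simp add: G_def w_def marginal_gap_def marginal_payoff_def power2_eq_square add.assoc)
  have diff: "utility \<beta>m \<beta>c \<epsilon> x' y - utility \<beta>m \<beta>c \<epsilon> x y = (x' $ 1 - x $ 1) * G (x' $ 1 - x $ 1)"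
    if "x' \<in> strategies X i" for x'
  proof -
    have "x' $ 2 = x $ 2 - (x' $ 1 - x $ 1)"
      using that x by (auto simp: strategies_def)
    then show ?thesis
      using utility_difference[OF True that y \<epsilon>, where \<beta>m = \<beta>m and \<beta>c = \<beta>c]
      by (simp add: G_def w_def)
  qed
  have shifted: "vector [x $ 1 + s, x $ 2 - s] \<in> strategies X i"
    if "- x $ 1 \<le> s" "s \<le> x $ 2" for s
    using that x by (simp add: strategies_def forall_2)
  have G_antimono: "G t \<le> G s" if "- x $ 1 \<le> s" "s \<le> t" "t \<le> x $ 2" for s t
  proof -
    have "\<beta>m $ 1 * w 1 / ((x $ 1 + w 1) * (x $ 1 + t + w 1))
        \<le> \<beta>m $ 1 * w 1 / ((x $ 1 + w 1) * (x $ 1 + s + w 1))"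
      using that pos w[of 1] \<beta>[of 1] by (intro divide_left_mono mult_left_mono mult_pos_pos) auto
    moreover have "\<beta>m $ 2 * w 2 / ((x $ 2 + w 2) * (x $ 2 - s + w 2))
        \<le> \<beta>m $ 2 * w 2 / ((x $ 2 + w 2) * (x $ 2 - t + w 2))"
      using that pos w[of 2] \<beta>[of 2] by (intro divide_left_mono mult_left_mono mult_pos_pos) auto
    ultimately show ?thesis
      by (simp add: G_def)
  qed
  have "isCont G 0"
    unfolding G_def using pos by (intro continuous_intros) auto
  \<comment> \<open>One-sided limits are taken because at a corner strategy only one sign of s is
    feasible.\<close>
  then have G_lim: "(G \<longlongrightarrow> G 0) (at_right 0)" "(G \<longlongrightarrow> G 0) (at_left 0)"
    by (auto simp: isCont_def filterlim_at_split)
  show ?thesis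
  proof
    assume br: "solves_best_response \<beta>m \<beta>c \<epsilon> X i x y"
    have le: "s * G s \<le> 0" if "- x $ 1 \<le> s" "s \<le> x $ 2" for s
      using br diff[OF shifted[OF that]] shifted[OF that]
      by (force simp: solves_best_response_def)
    have "G 0 \<le> 0" if "x $ 2 > 0"
    proof (rule tendsto_upperbound[OF G_lim(1)])
      show "\<forall>\<^sub>F s in at_right 0. G s \<le> 0"
        unfolding eventually_at_right_field
      proof (intro exI[of _ "x $ 2"] conjI allI impI)
        fix s assume "0 < s" "s < x $ 2"
        then show "G s \<le> 0"
          using le[of s] x by (simp add: mult_le_0_iff)
      qed (use that in simp)
    qed simp
    moreover have "G 0 \<ge> 0" if "x $ 1 > 0"
    proof (rule tendsto_lowerbound[OF G_lim(2)])
      show "\<forall>\<^sub>F s in at_left 0. 0 \<le> G s"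
        unfolding eventually_at_left_field
      proof (intro exI[of _ "- x $ 1"] conjI allI impI)
        fix s assume "- x $ 1 < s" "s < 0"
        then show "0 \<le> G s"
          using le[of s] x by (simp add: mult_le_0_iff)
      qed (use that in simp)
    qed simp
    ultimately show "x \<in> strategies X i
        \<and> (x $ 2 > 0 \<longrightarrow> marginal_gap \<beta>m \<beta>c \<epsilon> x y \<le> 0)
        \<and> (x $ 1 > 0 \<longrightarrow> marginal_gap \<beta>m \<beta>c \<epsilon> x y \<ge> 0)"
      using True G0 by simp
  next
    assume gap: "x \<in> strategies X i
        \<and> (x $ 2 > 0 \<longrightarrow> marginal_gap \<beta>m \<beta>c \<epsilon> x y \<le> 0)
        \<and> (x $ 1 > 0 \<longrightarrow> marginal_gap \<beta>m \<beta>c \<epsilon> x y \<ge> 0)"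
    have "utility \<beta>m \<beta>c \<epsilon> x' y \<le> utility \<beta>m \<beta>c \<epsilon> x y" if x': "x' \<in> strategies X i" for x'
    proof -
      define s where "s = x' $ 1 - x $ 1"
      have s: "- x $ 1 \<le> s" "s \<le> x $ 2"
        using x' x by (auto simp: strategies_def s_def forall_2)
      \<comment> \<open>A move with s < 0 requires \<open>x $ 1 > 0\<close>, hence G s \<ge> G 0
        \<ge> 0; a move with s > 0 requires \<open>x $ 2 > 0\<close>, hence G s \<le> G 0 \<le>
        0.\<close>
      have "s * G s \<le> 0"
      proof (cases s "0 :: real" rule: linorder_cases)
        case less
        then show ?thesis
          using gap s x G_antimono[of s 0] G0 by (intro mult_nonpos_nonneg) auto
      next
        case greater
        then show ?thesis
          using gap s x G_antimono[of 0 s] G0 by (intro mult_nonneg_nonpos) auto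
      qed simp
      then show ?thesis
        using diff[OF x'] by (simp add: s_def)
    qed
    then show "solves_best_response \<beta>m \<beta>c \<epsilon> X i x y"
      using True by (simp add: solves_best_response_def)
  qed
qed

section \<open>Strict monotonicity of the marginal payoffs and uniqueness of the equilibrium\<close>

lemma nash_equilibrium_iff_best_responses:
  "nash_equilibrium \<beta>m \<beta>c \<epsilon> X x \<longleftrightarrow>
     (\<forall>i. solves_best_response \<beta>m \<beta>c \<epsilon> X i (x i) (x (opponent i)))"
  by (auto simp: nash_equilibrium_def solves_best_response_def)

lemma all_players: "(\<forall>i. P i) \<longleftrightarrow> P Player_a \<and> P Player_b"
  by (metis player.exhaust)

text \<open>The midpoints are \<open>m\<close>, \<open>n\<close> and the half differences \<open>h\<close>, \<open>k\<close>. In these variables the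
  monotonicity inequality, multiplied by the common denominator, compares a positive definite
  quadratic form in \<open>h\<close>, \<open>k\<close> with a quartic term.\<close>

lemma quartic_less_quadratic_form:
  fixes m n e h k :: real
  assumes e: "e > 0" and m: "\<bar>h\<bar> \<le> m" and n: "\<bar>k\<bar> \<le> n" and ne: "h \<noteq> 0 \<or> k \<noteq> 0"
  shows "h * k * (h + k)\<^sup>2 < (m + n + e) * ((n + e) * h\<^sup>2 + (m + e) * k\<^sup>2 + e * h * k)"
proof -
  have mn: "m \<ge> 0" "n \<ge> 0"
    using m n by linarith+
  \<comment> \<open>Positive definiteness of this form makes the inequality strict: it collects all
    terms with factor \<open>e\<close>, leaving \<open>n * h\<^sup>2 + m * k\<^sup>2\<close> to
    dominate the quartic.\<close>
  have "h\<^sup>2 + k\<^sup>2 + h * k = (h + k / 2)\<^sup>2 + 3 / 4 * k\<^sup>2"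
    by (simp add: power2_eq_square algebra_simps)
  also have "\<dots> > 0"
  proof (cases "k = 0")
    case True
    then show ?thesis using ne by simp
  next
    case False
    then show ?thesis by (intro add_nonneg_pos) auto
  qed
  finally have "e * (h\<^sup>2 + k\<^sup>2 + h * k) > 0"
    using e by simp
  then have form: "n * h\<^sup>2 + m * k\<^sup>2 < (n + e) * h\<^sup>2 + (m + e) * k\<^sup>2 + e * h * k"
    by (simp add: algebra_simps)
  \<comment> \<open>One factor |h + k| is kept aside, to be bounded by m + n + e at the end; the
    other is split by the triangle inequality, and the resulting |k| and |h| are replaced by n and
    m.\<close>
  have "h * k * (h + k)\<^sup>2 = \<bar>h + k\<bar> * (h * k * \<bar>h + k\<bar>)"
    by (subst power2_abs[symmetric])
      (simp only: power2_eq_square mult.assoc mult.commute mult.left_commute)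
  also have "\<dots> \<le> \<bar>h + k\<bar> * (n * h\<^sup>2 + m * k\<^sup>2)"
  proof (rule mult_left_mono)
    have "h * k * \<bar>h + k\<bar> \<le> \<bar>h * k\<bar> * (\<bar>h\<bar> + \<bar>k\<bar>)"
      by (intro mult_mono abs_ge_self abs_triangle_ineq) auto
    also have "\<dots> = \<bar>k\<bar> * \<bar>h\<bar>\<^sup>2 + \<bar>h\<bar> * \<bar>k\<bar>\<^sup>2"
      by (simp only: abs_mult power2_eq_square) (simp only: algebra_simps)
    also have "\<dots> \<le> n * h\<^sup>2 + m * k\<^sup>2"
      unfolding power2_abs using m n by (intro add_mono mult_right_mono) auto
    finally show "h * k * \<bar>h + k\<bar> \<le> n * h\<^sup>2 + m * k\<^sup>2" .
  qed simp
  also have "\<dots> \<le> (m + n + e) * (n * h\<^sup>2 + m * k\<^sup>2)"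
    using m n e mn by (intro mult_right_mono) auto
  also have "\<dots> < (m + n + e) * ((n + e) * h\<^sup>2 + (m + e) * k\<^sup>2 + e * h * k)"
    using form e mn by (intro mult_strict_left_mono) auto
  finally show ?thesis .
qed

lemma marginal_field_strictly_monotone:
  fixes x y x' y' e :: real
  assumes nonneg: "x \<ge> 0" "y \<ge> 0" "x' \<ge> 0" "y' \<ge> 0" and e: "e > 0"
    and ne: "x \<noteq> x' \<or> y \<noteq> y'"
  shows "((y + e) / (x + y + e)\<^sup>2 - (y' + e) / (x' + y' + e)\<^sup>2) * (x - x')
    + ((x + e) / (x + y + e)\<^sup>2 - (x' + e) / (x' + y' + e)\<^sup>2) * (y - y') < 0"
proof -
  define S S' where "S = x + y + e" and "S' = x' + y' + e"
  have S: "S > 0" "S' > 0"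
    using nonneg e by (simp_all add: S_def S'_def add_nonneg_pos)
  define m n h k where "m = (x + x') / 2" and "n = (y + y') / 2"
    and "h = (x - x') / 2" and "k = (y - y') / 2"
  have xy: "x = m + h" "x' = m - h" "y = n + k" "y' = n - k"
    by (simp_all add: m_def n_def h_def k_def field_simps)
  \<comment> \<open>The bound |h| \<le> m says exactly that m + h and m - h are nonnegative, which
    are \<open>x\<close> and \<open>x'\<close>; likewise for k and n.\<close>
  have "h * k * (h + k)\<^sup>2 < (m + n + e) * ((n + e) * h\<^sup>2 + (m + e) * k\<^sup>2 + e * h * k)"
    using nonneg e ne by (intro quartic_less_quadratic_form) (auto simp: xy)
  \<comment> \<open>The numerator left after clearing the denominators
    \<open>S\<^sup>2 * S'\<^sup>2\<close>; in midpoint variables it is 8 times the difference of the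
    two sides just compared.\<close>
  moreover have "((y + e) * S'\<^sup>2 - (y' + e) * S\<^sup>2) * (x - x')
      + ((x + e) * S'\<^sup>2 - (x' + e) * S\<^sup>2) * (y - y')
    = 8 * (h * k * (h + k)\<^sup>2 - (m + n + e) * ((n + e) * h\<^sup>2 + (m + e) * k\<^sup>2 + e * h * k))"
    unfolding S_def S'_def xy by algebra
  ultimately have "(((y + e) * S'\<^sup>2 - (y' + e) * S\<^sup>2) * (x - x')
      + ((x + e) * S'\<^sup>2 - (x' + e) * S\<^sup>2) * (y - y')) / (S\<^sup>2 * S'\<^sup>2) < 0"
    using S by (intro divide_neg_pos) auto
  also have "(((y + e) * S'\<^sup>2 - (y' + e) * S\<^sup>2) * (x - x')
      + ((x + e) * S'\<^sup>2 - (x' + e) * S\<^sup>2) * (y - y')) / (S\<^sup>2 * S'\<^sup>2)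
    = ((y + e) / S\<^sup>2 - (y' + e) / S'\<^sup>2) * (x - x') + ((x + e) / S\<^sup>2 - (x' + e) / S'\<^sup>2) * (y - y')"
    using S by (simp add: add_divide_distrib diff_divide_distrib algebra_simps)
  finally show ?thesis
    by (simp add: S_def S'_def)
qed

text \<open>Merges the two sign conditions into one inequality that can be summed. If
  \<open>x' $ 1 < x $ 1\<close> then \<open>x $ 1 > 0\<close> and the gap is nonnegative; if
  \<open>x' $ 1 > x $ 1\<close> then, the totals being equal, \<open>x $ 2 > 0\<close> and the gap
  is nonpositive.\<close>

lemma best_response_variational_inequality:
  assumes y: "\<And>j. y $ j \<ge> 0" and \<beta>: "\<And>j. \<beta>m $ j > 0" and \<epsilon>: "\<And>j. \<epsilon> $ j > 0"
    and br: "solves_best_response \<beta>m \<beta>c \<epsilon> X i x y" and x': "x' \<in> strategies X i"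
  shows "marginal_gap \<beta>m \<beta>c \<epsilon> x y * (x' $ 1 - x $ 1) \<le> 0"
proof -
  have x: "x \<in> strategies X i" "x $ 2 > 0 \<Longrightarrow> marginal_gap \<beta>m \<beta>c \<epsilon> x y \<le> 0"
    "x $ 1 > 0 \<Longrightarrow> marginal_gap \<beta>m \<beta>c \<epsilon> x y \<ge> 0"
    using br solves_best_response_iff[OF y \<beta> \<epsilon>] by auto
  have sum: "x' $ 1 + x' $ 2 = x $ 1 + x $ 2" "x' $ 1 \<ge> 0" "x' $ 2 \<ge> 0"
    using x(1) x' by (auto simp: strategies_def)
  show ?thesis
  proof (cases "x' $ 1" "x $ 1" rule: linorder_cases)
    case less
    then show ?thesis using x(3) sum by (intro mult_nonneg_nonpos) auto
  next
    case greater
    then show ?thesis using x(2) sum by (intro mult_nonpos_nonneg) auto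
  qed simp
qed

text \<open>Each player's strategy in each equilibrium is tested against that player's strategy in
  the other. The four inequalities add up to a nonnegative quantity, which regroups by resource into
  terms D j weighted by \<open>\<beta>m $ j\<close>, both of them negative.\<close>

lemma nash_equilibrium_unique:
  assumes \<beta>: "\<And>j. \<beta>m $ j > 0" and \<epsilon>: "\<And>j. \<epsilon> $ j > 0"
    and ne: "nash_equilibrium \<beta>m \<beta>c \<epsilon> X x" and ne': "nash_equilibrium \<beta>m \<beta>c \<epsilon> X x'"
  shows "x = x'"
proof (rule ccontr)
  assume "x \<noteq> x'"
  define a b a' b' where "a = x Player_a" and "b = x Player_b"
    and "a' = x' Player_a" and "b' = x' Player_b"
  have strat: "a \<in> strategies X Player_a" "b \<in> strategies X Player_b"
    "a' \<in> strategies X Player_a" "b' \<in> strategies X Player_b"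
    using ne ne' by (auto simp: nash_equilibrium_def a_def b_def a'_def b'_def)
  then have nonneg: "a $ j \<ge> 0" "b $ j \<ge> 0" "a' $ j \<ge> 0" "b' $ j \<ge> 0" for j
    by (auto simp: strategies_def)
  have br: "solves_best_response \<beta>m \<beta>c \<epsilon> X Player_a a b" "solves_best_response \<beta>m \<beta>c \<epsilon> X Player_b b a"
    "solves_best_response \<beta>m \<beta>c \<epsilon> X Player_a a' b'" "solves_best_response \<beta>m \<beta>c \<epsilon> X Player_b b' a'"
    using ne ne'
    by (auto simp: nash_equilibrium_iff_best_responses all_players a_def b_def a'_def b'_def)
  define p q where "p = a $ 1 - a' $ 1" and "q = b $ 1 - b' $ 1"
  have p2: "a $ 2 - a' $ 2 = - p" and q2: "b $ 2 - b' $ 2 = - q"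
    using strat by (auto simp: strategies_def p_def q_def)
  have "p \<noteq> 0 \<or> q \<noteq> 0"
  proof (rule ccontr)
    assume "\<not> ?thesis"
    then have "a = a'" "b = b'"
      using p2 q2 by (auto simp: vec2_eq_iff p_def q_def)
    then have "x i = x' i" for i
      by (cases i) (auto simp: a_def b_def a'_def b'_def)
    then show False using \<open>x \<noteq> x'\<close> by blast
  qed
  define U V where "U a b j = (b $ j + \<epsilon> $ j) / (a $ j + b $ j + \<epsilon> $ j)\<^sup>2"
    and "V a b j = (a $ j + \<epsilon> $ j) / (a $ j + b $ j + \<epsilon> $ j)\<^sup>2" for a b :: "real ^ 2" and j
  define D where "D j = (U a b j - U a' b' j) * (a $ j - a' $ j)
    + (V a b j - V a' b' j) * (b $ j - b' $ j)" for j
  have D: "D j < 0" if "a $ j \<noteq> a' $ j \<or> b $ j \<noteq> b' $ j" for j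
    unfolding D_def U_def V_def using that by (intro marginal_field_strictly_monotone nonneg \<epsilon>)
  \<comment> \<open>With fixed totals, a change on one resource is mirrored on the other, so both
    terms are strictly negative.\<close>
  have "D 1 < 0" "D 2 < 0"
    using \<open>p \<noteq> 0 \<or> q \<noteq> 0\<close> p2 q2 by (auto intro!: D simp: p_def q_def)
  then have neg: "\<beta>m $ 1 * D 1 + \<beta>m $ 2 * D 2 < 0"
    using \<beta> by (intro add_neg_neg mult_pos_neg) auto
  let ?g = "marginal_gap \<beta>m \<beta>c \<epsilon>"
  have "?g a b * - p \<le> 0" "?g b a * - q \<le> 0" "?g a' b' * p \<le> 0" "?g b' a' * q \<le> 0"
    using best_response_variational_inequality[OF nonneg(2) \<beta> \<epsilon> br(1) strat(3)]
      best_response_variational_inequality[OF nonneg(1) \<beta> \<epsilon> br(2) strat(4)]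
      best_response_variational_inequality[OF nonneg(4) \<beta> \<epsilon> br(3) strat(1)]
      best_response_variational_inequality[OF nonneg(3) \<beta> \<epsilon> br(4) strat(2)]
    by (simp_all add: p_def q_def)
  then have "0 \<le> (?g a b - ?g a' b') * p + (?g b a - ?g b' a') * q"
    by (simp add: algebra_simps)
  \<comment> \<open>The costs \<open>\<beta>c\<close> cancel between the two equilibria, and the
    minus sign before resource 2 in the gap is absorbed by the mirrored differences -p and
    -q.\<close>
  also have "\<dots> = \<beta>m $ 1 * D 1 + \<beta>m $ 2 * D 2"
  proof -
    have U: "?g a b = \<beta>m $ 1 * U a b 1 - \<beta>c $ 1 - (\<beta>m $ 2 * U a b 2 - \<beta>c $ 2)"
      and V: "?g b a = \<beta>m $ 1 * V a b 1 - \<beta>c $ 1 - (\<beta>m $ 2 * V a b 2 - \<beta>c $ 2)" for a b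
      by (simp_all add: marginal_gap_def marginal_payoff_def U_def V_def add.commute)
    show ?thesis
      unfolding D_def p2 q2 p_def[symmetric] q_def[symmetric]
        U[of a b] U[of a' b'] V[of b a] V[of b' a']
      by (simp add: algebra_simps)
  qed
  finally show False using neg by simp
qed

section \<open>The two profiles in which player a uses a single resource\<close>

theorem theorem3:
  fixes \<beta>m \<beta>c \<epsilon> :: "real ^ 2" and X :: "player \<Rightarrow> real" and z1 z2 :: real
    and Xa Xb :: real and x1 x2 :: "player \<Rightarrow> real ^ 2"
  defines "Xa \<equiv> X Player_a" and "Xb \<equiv> X Player_b"
  defines "x1 \<equiv> profile (vector [0, Xa]) (vector [z1, Xb - z1])"
    and "x2 \<equiv> profile (vector [Xa, 0]) (vector [z2, Xb - z2])"
  assumes "Xa > 0" and "Xb > 0"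
    and "\<And>j. \<beta>m $ j > 0" and "\<And>j. \<epsilon> $ j > 0"
    and "z1 \<in> {0..Xb}" and "z2 \<in> {0..Xb}"
    and "solves_best_response \<beta>m \<beta>c \<epsilon> X Player_b (x1 Player_b) (x1 Player_a)"
    and "solves_best_response \<beta>m \<beta>c \<epsilon> X Player_b (x2 Player_b) (x2 Player_a)"
  shows
    "(nash_equilibrium \<beta>m \<beta>c \<epsilon> X x1 \<longleftrightarrow>
        (z1 \<in> {0<..<Xb} \<and>
           (Xb - z1 - Xa) * \<beta>m $ 2 / (Xa + Xb - z1 + \<epsilon> $ 2)\<^sup>2
           - \<beta>m $ 1 * z1 / (z1 + \<epsilon> $ 1)\<^sup>2 \<ge> 0)
      \<or> (z1 = 0 \<and>
           - V_upper \<beta>m \<beta>c \<epsilon> X + (Xb - Xa) * \<beta>m $ 2 / (Xa + Xb + \<epsilon> $ 2)\<^sup>2 \<ge> 0))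
   \<and> (nash_equilibrium \<beta>m \<beta>c \<epsilon> X x1 \<longrightarrow> (\<forall>x. nash_equilibrium \<beta>m \<beta>c \<epsilon> X x \<longrightarrow> x = x1))
   \<and> (nash_equilibrium \<beta>m \<beta>c \<epsilon> X x2 \<longleftrightarrow>
        (z2 \<in> {0<..<Xb} \<and>
           (z2 - Xa) * \<beta>m $ 1 / (Xa + z2 + \<epsilon> $ 1)\<^sup>2
           - (Xb - z2) * \<beta>m $ 2 / (Xb - z2 + \<epsilon> $ 2)\<^sup>2 \<ge> 0)
      \<or> (z2 = Xb \<and>
           W_lower \<beta>m \<beta>c \<epsilon> X + (Xb - Xa) * \<beta>m $ 1 / (Xa + Xb + \<epsilon> $ 1)\<^sup>2 \<ge> 0))
   \<and> (nash_equilibrium \<beta>m \<beta>c \<epsilon> X x2 \<longrightarrow> (\<forall>x. nash_equilibrium \<beta>m \<beta>c \<epsilon> X x \<longrightarrow> x = x2))"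
proof -
  note \<beta> = assms(7) and \<epsilon> = assms(8)
  let ?g = "marginal_gap \<beta>m \<beta>c \<epsilon>"
  have Xa: "Xa > 0" and Xb: "Xb > 0" and z1: "0 \<le> z1" "z1 \<le> Xb" and z2: "0 \<le> z2" "z2 \<le> Xb"
    using assms by auto
  have \<epsilon>1: "\<epsilon> $ 1 > 0" and \<epsilon>2: "\<epsilon> $ 2 > 0" and \<beta>1: "\<beta>m $ 1 > 0" and \<beta>2: "\<beta>m $ 2 > 0"
    using \<beta> \<epsilon> by auto
  define a1 a2 b1 b2 :: "real ^ 2" where "a1 = vector [0, Xa]" and "a2 = vector [Xa, 0]"
    and "b1 = vector [z1, Xb - z1]" and "b2 = vector [z2, Xb - z2]"
  note ab_defs = a1_def a2_def b1_def b2_def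
  have nonneg: "a1 $ j \<ge> 0" "a2 $ j \<ge> 0" "b1 $ j \<ge> 0" "b2 $ j \<ge> 0" for j
    using exhaust_2[of j] Xa z1 z2 by (auto simp: ab_defs)
  have strat: "a1 \<in> strategies X Player_a" "a2 \<in> strategies X Player_a"
    using nonneg by (auto simp: strategies_def ab_defs Xa_def)
  have br1: "solves_best_response \<beta>m \<beta>c \<epsilon> X Player_b b1 a1"
    and br2: "solves_best_response \<beta>m \<beta>c \<epsilon> X Player_b b2 a2"
    using assms(11,12) by (auto simp: x1_def x2_def profile_def ab_defs)
  have foc1: "z1 < Xb \<Longrightarrow> ?g b1 a1 \<le> 0" "z1 > 0 \<Longrightarrow> ?g b1 a1 \<ge> 0"
    using br1 solves_best_response_iff[OF nonneg(1) \<beta> \<epsilon>] by (auto simp: b1_def)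
  have foc2: "z2 < Xb \<Longrightarrow> ?g b2 a2 \<le> 0" "z2 > 0 \<Longrightarrow> ?g b2 a2 \<ge> 0"
    using br2 solves_best_response_iff[OF nonneg(2) \<beta> \<epsilon>] by (auto simp: b2_def)
  \<comment> \<open>Player b's optimality is assumed. Player a puts nothing on resource 1, so only
    the condition for a positive second coordinate remains. For \<open>x2\<close> the roles of the
    resources are exchanged, which reverses the sign.\<close>
  have nash1: "nash_equilibrium \<beta>m \<beta>c \<epsilon> X x1 \<longleftrightarrow> ?g a1 b1 \<le> 0"
    using br1 strat(1) Xa solves_best_response_iff[OF nonneg(3) \<beta> \<epsilon>, of \<beta>c X Player_a a1]
    by (simp add: nash_equilibrium_iff_best_responses all_players x1_def profile_def flip: ab_defs)
      (simp add: a1_def)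
  have nash2: "nash_equilibrium \<beta>m \<beta>c \<epsilon> X x2 \<longleftrightarrow> ?g a2 b2 \<ge> 0"
    using br2 strat(2) Xa solves_best_response_iff[OF nonneg(4) \<beta> \<epsilon>, of \<beta>c X Player_a a2]
    by (simp add: nash_equilibrium_iff_best_responses all_players x2_def profile_def flip: ab_defs)
      (simp add: a2_def)
  \<comment> \<open>At z1 = 0 the marginal payoff on resource 1 contains
    \<open>\<beta>m $ 1 * \<epsilon> $ 1 / (\<epsilon> $ 1)\<^sup>2\<close>, whereas
    \<open>V_upper\<close> has the reduced fraction; this puts both in the same form. The same
    happens in \<open>W_lower\<close> on resource 2.\<close>
  have quot: "\<beta> / t = \<beta> * t / t\<^sup>2" for \<beta> t :: real
    by (simp add: power2_eq_square)
  define Q1 Q2 where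
    "Q1 = (Xb - z1 - Xa) * \<beta>m $ 2 / (Xa + Xb - z1 + \<epsilon> $ 2)\<^sup>2 - \<beta>m $ 1 * z1 / (z1 + \<epsilon> $ 1)\<^sup>2"
    and "Q2 = (z2 - Xa) * \<beta>m $ 1 / (Xa + z2 + \<epsilon> $ 1)\<^sup>2
      - (Xb - z2) * \<beta>m $ 2 / (Xb - z2 + \<epsilon> $ 2)\<^sup>2"
  \<comment> \<open>On each resource both players face the same denominator and the same cost, so
    the gaps differ only through the numerators and \<open>\<beta>c\<close> drops out.\<close>
  have gap1: "?g a1 b1 = ?g b1 a1 - Q1"
  proof -
    have "Xa + (Xb - z1) + \<epsilon> $ 2 = Xa + Xb - z1 + \<epsilon> $ 2" 
      "Xb - z1 + Xa + \<epsilon> $ 2 = Xa + Xb - z1 + \<epsilon> $ 2"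
      by simp_all
    then show ?thesis
      by (simp add: marginal_gap_def marginal_payoff_def a1_def b1_def Q1_def
          add_divide_distrib diff_divide_distrib algebra_simps)
  qed
  have gap2: "?g a2 b2 = ?g b2 a2 + Q2"
  proof -
    have "z2 + Xa + \<epsilon> $ 1 = Xa + z2 + \<epsilon> $ 1"
      by simp
    then show ?thesis
      by (simp add: marginal_gap_def marginal_payoff_def a2_def b2_def Q2_def
          add_divide_distrib diff_divide_distrib algebra_simps)
  qed
  have "nash_equilibrium \<beta>m \<beta>c \<epsilon> X x1 \<longleftrightarrow> z1 \<in> {0<..<Xb} \<and> Q1 \<ge> 0
    \<or> z1 = 0 \<and> - V_upper \<beta>m \<beta>c \<epsilon> X + (Xb - Xa) * \<beta>m $ 2 / (Xa + Xb + \<epsilon> $ 2)\<^sup>2 \<ge> 0"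
  proof -
    consider "z1 = 0" | "0 < z1" "z1 < Xb" | "z1 = Xb"
      using z1 by linarith
    then show ?thesis
    proof cases
      case 1
      \<comment> \<open>At this endpoint player b's first-order condition is only an inequality and
        cannot eliminate \<open>\<beta>c\<close>; player a's gap is therefore evaluated
        directly.\<close>
      have "?g a1 b1 = V_upper \<beta>m \<beta>c \<epsilon> X - (Xb - Xa) * \<beta>m $ 2 / (Xa + Xb + \<epsilon> $ 2)\<^sup>2"
        using 1 unfolding V_upper_def quot[of _ "\<epsilon> $ 1"] Xa_def[symmetric] Xb_def[symmetric]
        by (simp add: marginal_gap_def marginal_payoff_def a1_def b1_def
            add_divide_distrib diff_divide_distrib algebra_simps)
      then show ?thesis using 1 nash1 by auto
    next
      case 2
      \<comment> \<open>At an interior point both one-sided conditions hold, so player a's gap is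
        exactly -Q1.\<close>
      then have "?g b1 a1 = 0" using foc1 by simp
      then show ?thesis using 2 nash1 gap1 by simp
    next
      case 3
      \<comment> \<open>With player b entirely on resource 1, b's gap is nonnegative, so Q1 < 0
        makes a's gap positive: player a gains by moving there too, and both sides of the
        equivalence are false.\<close>
      have "Q1 < 0"
      proof -
        have "\<beta>m $ 1 * Xb / (Xb + \<epsilon> $ 1)\<^sup>2 > 0" "Xa * \<beta>m $ 2 / (Xa + \<epsilon> $ 2)\<^sup>2 > 0"
          using \<beta>1 \<beta>2 \<epsilon>1 \<epsilon>2 Xa Xb by (auto intro!: divide_pos_pos zero_less_power)
        then show ?thesis using 3 by (simp add: Q1_def)
      qed
      then show ?thesis using 3 Xb nash1 gap1 foc1(2) by simp
    qed
  qed
  moreover have "nash_equilibrium \<beta>m \<beta>c \<epsilon> X x2 \<longleftrightarrow> z2 \<in> {0<..<Xb} \<and> Q2 \<ge> 0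
    \<or> z2 = Xb \<and> W_lower \<beta>m \<beta>c \<epsilon> X + (Xb - Xa) * \<beta>m $ 1 / (Xa + Xb + \<epsilon> $ 1)\<^sup>2 \<ge> 0"
  proof -
    consider "z2 = Xb" | "0 < z2" "z2 < Xb" | "z2 = 0"
      using z2 by linarith
    then show ?thesis
    proof cases
      case 1
      have "?g a2 b2 = W_lower \<beta>m \<beta>c \<epsilon> X + (Xb - Xa) * \<beta>m $ 1 / (Xa + Xb + \<epsilon> $ 1)\<^sup>2"
        using 1 unfolding W_lower_def quot[of _ "\<epsilon> $ 2"] Xa_def[symmetric] Xb_def[symmetric]
        by (simp add: marginal_gap_def marginal_payoff_def a2_def b2_def
            add_divide_distrib diff_divide_distrib algebra_simps)
      then show ?thesis using 1 nash2 by auto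
    next
      case 2
      then have "?g b2 a2 = 0" using foc2 by simp
      then show ?thesis using 2 nash2 gap2 by simp
    next
      case 3
      \<comment> \<open>The mirror image: player b is entirely on resource 2 with nonpositive gap,
        so a's gap is negative and \<open>x2\<close> is not an equilibrium.\<close>
      have "Q2 < 0"
      proof -
        have "\<beta>m $ 2 * Xb / (Xb + \<epsilon> $ 2)\<^sup>2 > 0" "Xa * \<beta>m $ 1 / (Xa + \<epsilon> $ 1)\<^sup>2 > 0"
          using \<beta>1 \<beta>2 \<epsilon>1 \<epsilon>2 Xa Xb by (auto intro!: divide_pos_pos zero_less_power)
        then show ?thesis using 3 by (simp add: Q2_def mult.commute)
      qed
      then show ?thesis using 3 Xb nash2 gap2 foc2(1) by simp
    qed
  qed
  ultimately show ?thesis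
    using nash_equilibrium_unique[OF \<beta> \<epsilon>] unfolding Q1_def Q2_def by blast
qed

end
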